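(* Let $f$ be a tropical transcendental meromorphic function of hyper-order $\rho_2(f)<1$, let $\alpha\in\mathbb{R}$ with $\alpha\neq\pm1$, and let $c\in\mathbb{R}$. Then $$f(x)^{\otimes\alpha}\otimes f(x+c)=\alpha f(x)+f(x+c)$$ is not a linear function, i.e. it is not of the form $ax+b$ with $a,b\in\mathbb{R}$.
   Context: A tropical meromorphic function is a continuous piecewise linear function $f:\mathbb{R}\to\mathbb{R}$ (arbitrary real slopes, points of slope change having no accumulation point in $\mathbb{R}$). For $x_0\in\mathbb{R}$ put $\omega_f(x_0)=\lim_{\varepsilon\to0^+}[f'(x_0+\varepsilon)-f'(x_0-\varepsilon)]$; $x_0$ is a root of $f$ of multiplicity $\omega_f(x_0)$ if $\omega_f(x_0)>0$, and a pole of multiplicity $\tau_f(x_0)=-\omega_f(x_0)$ if $\omega_f(x_0)<0$. A tropical meromorphic function is transcendental if it has infinitely many roots or infinitely many poles in total (equivalently, it is not a difference of two tropical polynomials, a tropical polynomial being a tropical meromorphic function with finitely many roots and no poles). With $f^+=\max\{f,0\}$, define $m(r,f)=\frac12\left(f^+(r)+f^+(-r)\right)$, $N(r,f)=\frac12\sum_{|b_\nu|<r}\tau_f(b_\nu)(r-|b_\nu|)$ (sum over the poles $b_\nu$ of $f$ in $(-r,r)$), $T(r,f)=m(r,f)+N(r,f)$, and the hyper-order $\rho_2(f)=\limsup_{r\to\infty}\frac{\log\log T(r,f)}{\log r}$. Max-plus notation: $x\otimes y=x+y$, $x^{\otimes\alpha}=\alpha x$. *)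

theory Defs
  imports "HOL-Analysis.Analysis"
begin

definition slope_changes :: "(real \<Rightarrow> real) \<Rightarrow> real set" where
  "slope_changes f = {x. \<not> (\<exists>a b. \<forall>\<^sub>F y in nhds x. f y = a * y + b)}"

definition tropical_meromorphic :: "(real \<Rightarrow> real) \<Rightarrow> bool" where
  "tropical_meromorphic f \<longleftrightarrow>
     continuous_on UNIV f \<and> (\<forall>x. \<not> x islimpt slope_changes f)"

text \<open>
  For tropical meromorphic functions the limit below always exists, since such a
  function is affine on a small interval on either side of any point.
\<close>

definition trop_omega :: "(real \<Rightarrow> real) \<Rightarrow> real \<Rightarrow> real" where
  "trop_omega f x = Lim (at_right 0) (\<lambda>\<epsilon>. deriv f (x + \<epsilon>) - deriv f (x - \<epsilon>))"

definition trop_tau :: "(real \<Rightarrow> real) \<Rightarrow> real \<Rightarrow> real" where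
  "trop_tau f x = - trop_omega f x"

definition trop_roots :: "(real \<Rightarrow> real) \<Rightarrow> real set" where
  "trop_roots f = {x. trop_omega f x > 0}"

definition trop_poles :: "(real \<Rightarrow> real) \<Rightarrow> real set" where
  "trop_poles f = {x. trop_omega f x < 0}"

definition tropical_transcendental :: "(real \<Rightarrow> real) \<Rightarrow> bool" where
  "tropical_transcendental f \<longleftrightarrow>
     tropical_meromorphic f \<and> (infinite (trop_roots f) \<or> infinite (trop_poles f))"

definition trop_proximity :: "real \<Rightarrow> (real \<Rightarrow> real) \<Rightarrow> real" where
  "trop_proximity r f = (max (f r) 0 + max (f (- r)) 0) / 2"

text \<open>
  The index set of the sum is finite for tropical meromorphic functions, because the
  poles are slope changes and these do not accumulate.
\<close>

definition trop_counting :: "real \<Rightarrow> (real \<Rightarrow> real) \<Rightarrow> real" where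
  "trop_counting r f =
     (\<Sum>b\<in>{b \<in> trop_poles f. \<bar>b\<bar> < r}. trop_tau f b * (r - \<bar>b\<bar>)) / 2"

definition trop_characteristic :: "real \<Rightarrow> (real \<Rightarrow> real) \<Rightarrow> real" where
  "trop_characteristic r f = trop_proximity r f + trop_counting r f"

text \<open>
  The upper limit is taken in the extended reals. For transcendental functions
  the characteristic tends to infinity, so the values of \<^const>\<open>ln\<close> at nonpositive
  arguments do not affect it.
\<close>

definition hyper_order :: "(real \<Rightarrow> real) \<Rightarrow> ereal" where
  "hyper_order f =
     Limsup at_top (\<lambda>r::real. ereal (ln (ln (trop_characteristic r f)) / ln r))"

end

theory Submission
  imports Defs "HOL-Real_Asymp.Real_Asymp"
begin

text \<open>
  Since \<open>\<alpha> \<noteq> -1\<close>, subtracting a suitable affine function from \<open>f\<close> makes the equation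
  homogeneous, and iterating it once gives \<open>h (x + 2 c) = \<alpha>\<^sup>2 h x\<close>. Up to replacing \<open>c\<close> by \<open>-c\<close>
  this is \<open>h (x + d) = B h x\<close> with \<open>B > 1\<close>. If \<open>h\<close> is positive somewhere, its values, and hence
  the proximity function, grow exponentially along an arithmetic progression. If \<open>h \<le> 0\<close> and
  \<open>h y < 0\<close>, then \<open>h y\<close> exceeds the mean of \<open>h (y - d)\<close> and \<open>h (y + d)\<close>, so \<open>f\<close> is not convex
  and has a pole; the pole multiplicities are multiplied by \<open>B\<close> under translation by \<open>d\<close>, so the
  counting function grows exponentially. Exponential growth means hyper-order at least 1.
\<close>

section \<open>Local structure of tropical meromorphic functions\<close>

text \<open>Off the slope changes \<open>deriv f\<close> is locally constant, so its derivative
  vanishes and connectedness yields one slope on the open interval. Continuity extends the formula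
  to \<open>u\<close> and \<open>v\<close>, which may themselves be slope changes.\<close>

lemma affine_between_slope_changes:
  fixes f :: "real \<Rightarrow> real"
  assumes cont: "continuous_on UNIV f" and "u < v"
    and no_change: "\<And>y. u < y \<Longrightarrow> y < v \<Longrightarrow> y \<notin> slope_changes f"
  obtains s where "\<And>y z. u \<le> y \<Longrightarrow> y \<le> v \<Longrightarrow> u \<le> z \<Longrightarrow> z \<le> v \<Longrightarrow> f y = f z + s * (y - z)"
proof -
  have loc: "(f has_field_derivative deriv f y) (at y)"
    "(deriv f has_field_derivative 0) (at y)" if y: "u < y" "y < v" for y
  proof -
    obtain a b where ev: "\<forall>\<^sub>F z in nhds y. f z = a * z + b"
      using no_change[OF y] unfolding slope_changes_def by blast
    have der: "(f has_field_derivative a) (at z)" if "\<forall>\<^sub>F w in nhds z. f w = a * w + b" for z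
    proof -
      have "((\<lambda>w. a * w + b) has_field_derivative a) (at z)"
        by (auto intro!: derivative_eq_intros)
      then show ?thesis using DERIV_cong_ev[OF refl that refl] by blast
    qed
    \<comment> \<open>Differentiating \<open>deriv f\<close> at \<open>y\<close> requires its value
      at all points near \<open>y\<close>, not only at \<open>y\<close>.\<close>
    from ev have "\<forall>\<^sub>F z in nhds y. \<forall>\<^sub>F w in nhds z. f w = a * w + b"
      by (simp add: eventually_eventually)
    then have evd: "\<forall>\<^sub>F z in nhds y. deriv f z = a"
      by eventually_elim (rule DERIV_imp_deriv[OF der])
    show "(f has_field_derivative deriv f y) (at y)"
      using der[OF ev] DERIV_imp_deriv by metis
    show "(deriv f has_field_derivative 0) (at y)"
      using DERIV_cong_ev[OF refl evd refl] by auto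
  qed
  have "\<exists>s. \<forall>y\<in>{u<..<v}. deriv f y = s"
    by (rule has_field_derivative_zero_constant)
      (auto intro: loc has_field_derivative_at_within)
  then obtain s where s: "\<And>y. u < y \<Longrightarrow> y < v \<Longrightarrow> deriv f y = s" by auto
  have "\<exists>k. \<forall>y\<in>{u<..<v}. f y - s * y = k"
  proof (rule has_field_derivative_zero_constant)
    fix y assume "y \<in> {u<..<v}"
    then have "((\<lambda>y. f y - s * y) has_field_derivative (deriv f y - s)) (at y)"
      by (auto intro!: derivative_eq_intros loc)
    then show "((\<lambda>y. f y - s * y) has_field_derivative 0) (at y within {u<..<v})"
      using s \<open>y \<in> _\<close> by (auto intro: has_field_derivative_at_within)
  qed auto
  then obtain k where k: "\<And>y. y \<in> {u<..<v} \<Longrightarrow> f y - s * y = k" by auto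
  have "continuous_on (closure {u<..<v}) (\<lambda>y. f y - s * y)"
    by (intro continuous_intros continuous_on_subset[OF cont]) auto
  then have "f y - s * y = k" if "u \<le> y" "y \<le> v" for y
    using continuous_constant_on_closure[of "{u<..<v}" "\<lambda>y. f y - s * y" k y] k that \<open>u < v\<close>
    by auto
  then have "f y = f z + s * (y - z)" if "u \<le> y" "y \<le> v" "u \<le> z" "z \<le> v" for y z
    using that by (simp add: algebra_simps)
  then show thesis using that by blast
qed

text \<open>Here \<open>t\<close> is the left slope and \<open>s\<close> the right slope. Exact
  equality on a small interval stands in for one-sided limits of the derivative.\<close>

definition has_slopes :: "(real \<Rightarrow> real) \<Rightarrow> real \<Rightarrow> real \<Rightarrow> real \<Rightarrow> bool" where
  "has_slopes f x t s \<longleftrightarrow> (\<exists>d>0. \<forall>e. 0 \<le> e \<longrightarrow> e \<le> d \<longrightarrow>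
     f (x + e) = f x + s * e \<and> f (x - e) = f x - t * e)"

lemma tropical_meromorphic_has_slopes:
  assumes "tropical_meromorphic f"
  obtains t s where "has_slopes f x t s"
proof -
  have cont: "continuous_on UNIV f" and "\<not> x islimpt slope_changes f"
    using assms by (auto simp: tropical_meromorphic_def)
  then obtain d where "d > 0" and d: "\<And>y. y \<noteq> x \<Longrightarrow> dist y x < d \<Longrightarrow> y \<notin> slope_changes f"
    by (auto simp: islimpt_approachable)
  obtain s where s: "\<And>y z. x \<le> y \<Longrightarrow> y \<le> x + d \<Longrightarrow> x \<le> z \<Longrightarrow> z \<le> x + d \<Longrightarrow> f y = f z + s * (y - z)"
    using affine_between_slope_changes[OF cont, of x "x + d"] d \<open>d > 0\<close>
    by (auto simp: dist_real_def)
  obtain t where t: "\<And>y z. x - d \<le> y \<Longrightarrow> y \<le> x \<Longrightarrow> x - d \<le> z \<Longrightarrow> z \<le> x \<Longrightarrow> f y = f z + t * (y - z)"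
    using affine_between_slope_changes[OF cont, of "x - d" x] d \<open>d > 0\<close>
    by (auto simp: dist_real_def)
  have "has_slopes f x t s"
    unfolding has_slopes_def
  proof (intro exI[of _ d] conjI allI impI)
    fix e assume "0 \<le> e" "e \<le> d"
    then show "f (x + e) = f x + s * e" using s[of "x + e" x] by simp
    show "f (x - e) = f x - t * e" using t[of "x - e" x] \<open>0 \<le> e\<close> \<open>e \<le> d\<close> by simp
  qed fact
  then show thesis using that by blast
qed

text \<open>For small positive arguments the difference of derivatives already equals
  \<open>s - t\<close>, so the limit is that of an eventually constant function.\<close>

lemma trop_omega_eq:
  assumes "has_slopes f x t s"
  shows "trop_omega f x = s - t"
proof -
  obtain d where "d > 0" and R: "\<And>e. 0 \<le> e \<Longrightarrow> e \<le> d \<Longrightarrow> f (x + e) = f x + s * e"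
    and L: "\<And>e. 0 \<le> e \<Longrightarrow> e \<le> d \<Longrightarrow> f (x - e) = f x - t * e"
    using assms by (auto simp: has_slopes_def)
  have "deriv f (x + e) - deriv f (x - e) = s - t" if "0 < e" "e < d" for e
  proof -
    have "\<forall>\<^sub>F y in nhds (x + e). y \<in> {x<..<x + d}"
      using that by (intro eventually_nhds_in_open) auto
    then have "\<forall>\<^sub>F y in nhds (x + e). f y = f x + s * (y - x)"
    proof eventually_elim
      case (elim y) then show ?case using R[of "y - x"] by simp
    qed
    then have "(f has_field_derivative s) (at (x + e))"
      by (subst DERIV_cong_ev[OF refl _ refl]) (auto intro!: derivative_eq_intros)
    moreover have "\<forall>\<^sub>F y in nhds (x - e). y \<in> {x - d<..<x}"
      using that by (intro eventually_nhds_in_open) auto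
    then have "\<forall>\<^sub>F y in nhds (x - e). f y = f x + t * (y - x)"
    proof eventually_elim
      case (elim y) then show ?case using L[of "x - y"] by (simp add: algebra_simps)
    qed
    then have "(f has_field_derivative t) (at (x - e))"
      by (subst DERIV_cong_ev[OF refl _ refl]) (auto intro!: derivative_eq_intros)
    ultimately show ?thesis by (simp add: DERIV_imp_deriv)
  qed
  then have "\<forall>\<^sub>F e in at_right 0. deriv f (x + e) - deriv f (x - e) = s - t"
    using \<open>d > 0\<close> by (auto simp: eventually_at_right_field)
  then show ?thesis
    unfolding trop_omega_def by (intro tendsto_Lim tendsto_eventually) auto
qed

text \<open>This transfers the absence of accumulation points from slope changes to roots and
  poles.\<close>

lemma trop_omega_nonzero_slope_change:
  assumes "trop_omega f x \<noteq> 0"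
  shows "x \<in> slope_changes f"
proof (rule ccontr)
  assume "x \<notin> slope_changes f"
  then obtain a b where "\<forall>\<^sub>F y in nhds x. f y = a * y + b"
    by (auto simp: slope_changes_def)
  then obtain d where "d > 0" and d: "\<And>y. dist y x < d \<Longrightarrow> f y = a * y + b"
    by (auto simp: eventually_nhds_metric)
  have "has_slopes f x a a"
    unfolding has_slopes_def using \<open>d > 0\<close>
    by (intro exI[of _ "d / 2"]) (auto simp: d dist_real_def algebra_simps)
  then show False using trop_omega_eq assms by fastforce
qed

lemma tropical_transcendental_not_affine:
  assumes "tropical_transcendental f"
  shows "\<not> (\<exists>a b. \<forall>x. f x = a * x + b)"
proof
  assume "\<exists>a b. \<forall>x. f x = a * x + b"
  then have "slope_changes f = {}"
    by (auto simp: slope_changes_def intro: always_eventually)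
  then have "trop_omega f x = 0" for x
    using trop_omega_nonzero_slope_change[of f x] by auto
  then have "trop_roots f = {}" "trop_poles f = {}"
    by (auto simp: trop_roots_def trop_poles_def)
  then show False using assms by (simp add: tropical_transcendental_def)
qed

text \<open>The affine term adds the same \<open>p\<close> to both one-sided slopes and cancels in
  their difference.\<close>

lemma trop_omega_functional_equation:
  assumes "tropical_meromorphic f" and eq: "\<And>x. f (x + c) = B * f x + p * x + q"
  shows "trop_omega f (x + c) = B * trop_omega f x"
proof -
  obtain t s where ts: "has_slopes f x t s"
    using tropical_meromorphic_has_slopes[OF assms(1)] .
  have "f (x + c + e) = f (x + c) + (B * s + p) * e \<and> f (x + c - e) = f (x + c) - (B * t + p) * e"
    if "f (x + e) = f x + s * e \<and> f (x - e) = f x - t * e" for e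
    using eq[of "x + e"] eq[of "x - e"] eq[of x] that by (simp add: algebra_simps)
  then have "has_slopes f (x + c) (B * t + p) (B * s + p)"
    using ts unfolding has_slopes_def by meson
  then show ?thesis
    by (simp add: trop_omega_eq[OF ts] trop_omega_eq algebra_simps)
qed

text \<open>
  At the leftmost maximum point of \<open>f\<close> minus the chord, the left slope is strictly larger and the
  right slope is not larger than the slope of the chord.
\<close>

lemma pole_above_chord:
  assumes tm: "tropical_meromorphic f" and "d > 0"
    and above: "f y > (f (y - d) + f (y + d)) / 2"
  obtains x where "x \<in> trop_poles f"
proof -
  \<comment> \<open>Subtracting the chord slope \<open>k\<close> makes the two end values of
    \<open>g\<close> equal.\<close>
  define k where "k = (f (y + d) - f (y - d)) / (2 * d)"
  define g where "g = (\<lambda>x. f x - k * x)"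
  have kd: "2 * (k * d) = f (y + d) - f (y - d)"
    using \<open>d > 0\<close> by (simp add: k_def)
  then have ends: "g (y - d) = g (y + d)" "g (y - d) < g y"
    using above by (simp_all add: g_def algebra_simps)
  have "continuous_on UNIV f" using tm by (simp add: tropical_meromorphic_def)
  then have cg: "continuous_on {y - d..y + d} g"
    unfolding g_def by (intro continuous_intros) (auto intro: continuous_on_subset)
  obtain w where w: "w \<in> {y - d..y + d}" "\<And>z. z \<in> {y - d..y + d} \<Longrightarrow> g z \<le> g w"
    using continuous_attains_sup[OF _ _ cg] \<open>d > 0\<close> by auto
  define S where "S = {y - d..y + d} \<inter> g -` {g w}"
  have "closed S"
    unfolding S_def by (intro continuous_closed_preimage cg) auto
  moreover have "S \<noteq> {}" using w by (auto simp: S_def)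
  moreover have bb: "bdd_below S" by (auto simp: S_def intro: bdd_belowI[of _ "y - d"])
  ultimately have inS: "Inf S \<in> S" using closed_contains_Inf by blast
  define m where "m = Inf S"
  have m: "m \<in> {y - d..y + d}" "g m = g w" using inS by (auto simp: S_def m_def)
  \<comment> \<open>The maximum is interior, since both end values lie strictly below
    \<open>g y\<close>.\<close>
  have "g y \<le> g w" using w(2)[of y] \<open>d > 0\<close> by simp
  then have m_in: "y - d < m" "m < y + d"
    using m ends by (auto simp: order_less_le)
  have left: "g z < g w" if "y - d \<le> z" "z < m" for z
  proof -
    have "z \<notin> S" using that cInf_lower[OF _ bb, of z] by (auto simp: m_def)
    then show ?thesis using w(2)[of z] that m_in by (auto simp: S_def order_less_le)
  qed
  obtain t s where ts: "has_slopes f m t s"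
    using tropical_meromorphic_has_slopes[OF tm] .
  then obtain r where "r > 0" and r: "\<And>e. 0 \<le> e \<Longrightarrow> e \<le> r \<Longrightarrow>
     f (m + e) = f m + s * e \<and> f (m - e) = f m - t * e"
    by (auto simp: has_slopes_def)
  define e where "e = min r (min (m - (y - d)) (y + d - m))"
  have e: "e > 0" "e \<le> r" "y - d \<le> m - e" "m + e \<le> y + d"
    using m_in \<open>r > 0\<close> by (auto simp: e_def)
  have "g (m - e) < g m" using left[of "m - e"] e m by auto
  then have "e * k < e * t" using r[of e] e by (simp add: g_def algebra_simps)
  moreover have "g (m + e) \<le> g m" using w(2)[of "m + e"] e m by auto
  then have "e * s \<le> e * k" using r[of e] e by (simp add: g_def algebra_simps)
  ultimately have "s < t" using e by (smt (verit) mult_less_cancel_left_pos)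
  then show thesis
    using that[of m] trop_omega_eq[OF ts] by (simp add: trop_poles_def)
qed

section \<open>Growth of the characteristic function\<close>

lemma trop_counting_nonneg: "trop_counting r f \<ge> 0"
  unfolding trop_counting_def
  by (auto intro!: sum_nonneg mult_nonpos_nonneg simp: trop_poles_def trop_tau_def)

text \<open>One of the two points \<open>\<bar>x\<bar>\<close>, \<open>- \<bar>x\<bar>\<close>
  evaluated by the proximity function is \<open>x\<close>, and the counting function only adds to
  it.\<close>

lemma half_le_characteristic: "f x / 2 \<le> trop_characteristic \<bar>x\<bar> f"
proof -
  have "f x \<le> max (f \<bar>x\<bar>) 0 + max (f (- \<bar>x\<bar>)) 0"
    by (cases "x \<ge> 0") auto
  then have "f x / 2 \<le> trop_proximity \<bar>x\<bar> f"
    unfolding trop_proximity_def by (rule divide_right_mono) simp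
  then show ?thesis
    using trop_counting_nonneg[of "\<bar>x\<bar>" f] by (simp add: trop_characteristic_def)
qed

text \<open>By Bolzano-Weierstrass, infinitely many poles in a bounded interval would make slope
  changes accumulate.\<close>

lemma finite_poles_less:
  assumes "tropical_meromorphic f"
  shows "finite {b \<in> trop_poles f. \<bar>b\<bar> < r}"
proof (rule ccontr)
  assume inf: "infinite {b \<in> trop_poles f. \<bar>b\<bar> < r}"
  have sub: "{b \<in> trop_poles f. \<bar>b\<bar> < r} \<subseteq> {-r..r}" by auto
  obtain x where "x islimpt {b \<in> trop_poles f. \<bar>b\<bar> < r}"
    using compact_eq_Bolzano_Weierstrass[of "{-r..r}"] inf sub by (metis compact_Icc)
  moreover have "{b \<in> trop_poles f. \<bar>b\<bar> < r} \<subseteq> slope_changes f"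
    using trop_omega_nonzero_slope_change by (force simp: trop_poles_def)
  ultimately have "x islimpt slope_changes f" by (rule islimpt_subset)
  then show False using assms by (simp add: tropical_meromorphic_def)
qed

text \<open>At radius \<open>\<bar>b\<bar> + 1\<close> the pole \<open>b\<close> has weight 1 in the
  counting sum, and all other terms are nonnegative.\<close>

lemma pole_le_characteristic:
  assumes tm: "tropical_meromorphic f" and b: "b \<in> trop_poles f"
  shows "trop_tau f b / 2 \<le> trop_characteristic (\<bar>b\<bar> + 1) f"
proof -
  have "trop_tau f b * (\<bar>b\<bar> + 1 - \<bar>b\<bar>)
    \<le> (\<Sum>x\<in>{x \<in> trop_poles f. \<bar>x\<bar> < \<bar>b\<bar> + 1}. trop_tau f x * (\<bar>b\<bar> + 1 - \<bar>x\<bar>))"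
    by (rule member_le_sum[where f = "\<lambda>x. trop_tau f x * (\<bar>b\<bar> + 1 - \<bar>x\<bar>)"])
      (use b finite_poles_less[OF tm] in \<open>auto simp: trop_poles_def trop_tau_def mult_le_0_iff\<close>)
  then have "trop_tau f b / 2 \<le> trop_counting (\<bar>b\<bar> + 1) f"
    by (simp add: trop_counting_def)
  also have "\<dots> \<le> trop_characteristic (\<bar>b\<bar> + 1) f"
    by (simp add: trop_characteristic_def trop_proximity_def)
  finally show ?thesis .
qed

text \<open>Along the sequence, \<open>ln (ln T)\<close> is at least \<open>ln n\<close> up to a
  constant, while \<open>ln r\<close> is at most \<open>ln n\<close> up to a constant. The terms
  with \<open>D\<close> and \<open>E\<close> leave room for the affine part of
  \<open>f\<close>.\<close>

lemma hyper_order_ge_1: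
  fixes r :: "nat \<Rightarrow> real"
  assumes lim: "filterlim r at_top sequentially"
    and r_le: "\<And>n. r n \<le> A + C * real n" and "C > 0"
    and growth: "\<And>n. trop_characteristic (r n) f \<ge> K * B ^ n - D * real n - E"
    and "K > 0" "B > 1"
  shows "hyper_order f \<ge> 1"
proof (rule ccontr)
  assume "\<not> hyper_order f \<ge> 1"
  then have "hyper_order f < 1" by simp
  then obtain l where l: "hyper_order f < ereal l" "l < 1"
    using ereal_dense2[of "hyper_order f" 1] by auto
  then have "\<forall>\<^sub>F x in at_top. ereal (ln (ln (trop_characteristic x f)) / ln x) < ereal l"
    unfolding hyper_order_def by (intro Limsup_lessD)
  then have ev: "\<forall>\<^sub>F n in sequentially. ln (ln (trop_characteristic (r n) f)) / ln (r n) < l"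
    using lim by (auto simp: filterlim_iff)
  have big: "\<forall>\<^sub>F n in sequentially. r n > 1"
    using lim by (auto simp: filterlim_at_top_dense)
  \<comment> \<open>This is half the exponential rate of \<open>B ^ n\<close>; the other half
    absorbs \<open>K\<close>, \<open>D\<close> and \<open>E\<close>.\<close>
  define \<delta> where "\<delta> = ln B / 2"
  have "\<delta> > 0" using \<open>B > 1\<close> by (simp add: \<delta>_def)
  have B: "B ^ n = exp (2 * \<delta> * real n)" for n
    using \<open>B > 1\<close> by (simp add: \<delta>_def exp_of_nat2_mult)
  have exp_growth: "\<forall>\<^sub>F n in sequentially. exp (\<delta> * real n) \<le> K * exp (2 * \<delta> * real n) - D * real n - E"
    using \<open>\<delta> > 0\<close> \<open>K > 0\<close> by real_asymp
  \<comment> \<open>A negative factor would reverse the inequality when \<open>r n\<close> is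
    replaced by its upper bound.\<close>
  define l' where "l' = max l 0"
  have "l' < 1" "l' \<ge> 0" "l \<le> l'" using l by (auto simp: l'_def)
  have "\<forall>\<^sub>F n in sequentially. l' * ln (A + C * real n) < ln (\<delta> * real n)"
    using \<open>l' < 1\<close> \<open>l' \<ge> 0\<close> \<open>C > 0\<close> \<open>\<delta> > 0\<close> by real_asymp
  moreover have "\<forall>\<^sub>F n in sequentially. \<delta> * real n > 1"
    using \<open>\<delta> > 0\<close> by real_asymp
  ultimately have "\<forall>\<^sub>F n :: nat in sequentially. False"
    using ev big exp_growth
  proof eventually_elim
    case (elim n)
    have T: "exp (\<delta> * real n) \<le> trop_characteristic (r n) f"
      using elim(5) growth[of n] by (simp add: B)
    then have "\<delta> * real n \<le> ln (trop_characteristic (r n) f)"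
      using ln_le_cancel_iff[of "exp (\<delta> * real n)"] by (smt (verit) exp_gt_zero ln_exp)
    then have "ln (\<delta> * real n) \<le> ln (ln (trop_characteristic (r n) f))"
      using elim(2) by simp
    also have "\<dots> < l * ln (r n)"
      using elim(3,4) by (simp add: divide_less_eq)
    also have "\<dots> \<le> l' * ln (r n)"
      using \<open>l \<le> l'\<close> elim(4) by (intro mult_right_mono) auto
    also have "\<dots> \<le> l' * ln (A + C * real n)"
      using \<open>l' \<ge> 0\<close> r_le[of n] elim(4) by (intro mult_left_mono) auto
    finally show False using elim(1) by simp
  qed
  then show False by simp
qed

section \<open>Growth forced by a multiplicative functional equation\<close>

lemma hyper_order_ge_1_of_multiplicative:
  assumes tm: "tropical_meromorphic f" and f: "\<And>x. f x = h x + (p * x + q)"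
    and h: "\<And>x. h (x + c) = B * h x" and "B > 1" "c \<noteq> 0" and nz: "h y \<noteq> 0"
  shows "hyper_order f \<ge> 1"
proof -
  have abs_lim: "filterlim (\<lambda>n. \<bar>x + real n * c\<bar>) at_top sequentially" for x
  proof (rule filterlim_at_top_mono)
    show "filterlim (\<lambda>n. \<bar>c\<bar> * real n - \<bar>x\<bar>) at_top sequentially"
      using \<open>c \<noteq> 0\<close> by real_asymp
    have "\<bar>real n * c\<bar> = \<bar>c\<bar> * real n" for n by (simp add: abs_mult)
    then show "\<forall>\<^sub>F n in sequentially. \<bar>c\<bar> * real n - \<bar>x\<bar> \<le> \<bar>x + real n * c\<bar>"
      by (intro always_eventually allI) (smt (verit))
  qed
  have abs_le: "\<bar>x + real n * c\<bar> \<le> \<bar>x\<bar> + \<bar>c\<bar> * real n" for x n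
    using abs_triangle_ineq[of x "real n * c"] by (simp add: abs_mult mult.commute)
  show ?thesis
  proof (cases "\<exists>x. h x > 0")
    case True
    then obtain x where x: "h x > 0" by blast
    have hn: "h (x + real n * c) = B ^ n * h x" for n
    proof (induction n)
      case (Suc n)
      have "h (x + real (Suc n) * c) = h (x + real n * c + c)" by (simp add: algebra_simps)
      also have "\<dots> = B ^ Suc n * h x" by (simp only: h Suc.IH power_Suc mult.assoc)
      finally show ?case .
    qed simp
    show ?thesis
    proof (rule hyper_order_ge_1[OF abs_lim abs_le])
      fix n
      \<comment> \<open>The affine part is linear in \<open>n\<close> along the progression and
        supplies the constants \<open>D\<close> and \<open>E\<close>.\<close>
      have "f (x + real n * c) / 2 = h x / 2 * B ^ n - (- p * c / 2) * real n - (- (p * x + q) / 2)"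
        unfolding f hn by (simp add: field_simps)
      then show "h x / 2 * B ^ n - (- p * c / 2) * real n - (- (p * x + q) / 2)
          \<le> trop_characteristic \<bar>x + real n * c\<bar> f"
        using half_le_characteristic[of f "x + real n * c"] by (simp only:)
    qed (use x \<open>B > 1\<close> \<open>c \<noteq> 0\<close> in auto)
  next
    case False
    then have neg: "h y < 0" using nz by (meson linorder_neqE_linordered_idom)
    \<comment> \<open>By the strict inequality \<open>B + inverse B > 2\<close>, reversed by the
      negative factor \<open>h y\<close>.\<close>
    have "h y * (B + inverse B) < h y * 2"
    proof -
      have "0 < (B - 1)\<^sup>2" using \<open>B > 1\<close> by simp
      then have "2 < B + inverse B"
        using \<open>B > 1\<close> by (simp add: field_simps power2_eq_square)
      then show ?thesis using neg by simp
    qed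
    moreover have "h (y - c) = inverse B * h y"
      using h[of "y - c"] \<open>B > 1\<close> by (simp add: field_simps)
    ultimately have "f y > (f (y - c) + f (y + c)) / 2"
      using h[of y] by (simp add: f algebra_simps)
    \<comment> \<open>The mean is symmetric in the sign of \<open>c\<close>, and the chord lemma
      needs a positive half-width.\<close>
    then have "f y > (f (y - \<bar>c\<bar>) + f (y + \<bar>c\<bar>)) / 2"
      by (auto simp: abs_if add.commute)
    then obtain x where "x \<in> trop_poles f"
      using pole_above_chord[OF tm, of "\<bar>c\<bar>" y] \<open>c \<noteq> 0\<close> by auto
    then have x: "trop_tau f x > 0" by (simp add: trop_poles_def trop_tau_def)
    have feq: "f (z + c) = B * f z + (p - B * p) * z + (p * c + q - B * q)" for z
      unfolding f h by (simp add: algebra_simps)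
    have tau: "trop_tau f (x + real n * c) = B ^ n * trop_tau f x" for n
    proof (induction n)
      case (Suc n)
      then show ?case
        using trop_omega_functional_equation[OF tm feq, of "x + real n * c"]
        by (simp add: trop_tau_def algebra_simps)
    qed simp
    show ?thesis
    proof (rule hyper_order_ge_1)
      show "filterlim (\<lambda>n. \<bar>x + real n * c\<bar> + 1) at_top sequentially"
        by (rule filterlim_at_top_mono[OF abs_lim[of x]]) simp
      show "\<bar>x + real n * c\<bar> + 1 \<le> (\<bar>x\<bar> + 1) + \<bar>c\<bar> * real n" for n
        using abs_le[of x n] by simp
      fix n
      have "trop_tau f (x + real n * c) > 0" using tau x \<open>B > 1\<close> by simp
      then have "x + real n * c \<in> trop_poles f" by (simp add: trop_poles_def trop_tau_def)
      then show "trop_tau f x / 2 * B ^ n - 0 * real n - 0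
          \<le> trop_characteristic (\<bar>x + real n * c\<bar> + 1) f"
        using pole_le_characteristic[OF tm, of "x + real n * c"] tau[of n] by (simp add: mult.commute)
    qed (use x \<open>B > 1\<close> \<open>c \<noteq> 0\<close> in auto)
  qed
qed

theorem theorem7p5:
  fixes f :: "real \<Rightarrow> real" and \<alpha> c :: real
  assumes "tropical_transcendental f"
    and "hyper_order f < 1"
    and "\<alpha> \<noteq> 1" and "\<alpha> \<noteq> -1"
  shows "\<not> (\<exists>a b :: real. \<forall>x :: real. \<alpha> * f x + f (x + c) = a * x + b)"
proof
  assume "\<exists>a b. \<forall>x. \<alpha> * f x + f (x + c) = a * x + b"
  then obtain a b where eq: "\<And>x. \<alpha> * f x + f (x + c) = a * x + b" by blast
  have tm: "tropical_meromorphic f" using assms(1) by (simp add: tropical_transcendental_def)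
  have \<alpha>1: "1 + \<alpha> \<noteq> 0" using assms(4) by (simp add: add_eq_0_iff)
  \<comment> \<open>The coefficients are chosen so that \<open>p * x + q\<close> is a particular
    affine solution of the equation.\<close>
  define p where "p = a / (1 + \<alpha>)"
  define q where "q = (b - p * c) / (1 + \<alpha>)"
  define h where "h = (\<lambda>x. f x - (p * x + q))"
  have f: "f x = h x + (p * x + q)" for x by (simp add: h_def)
  have "p * (1 + \<alpha>) = a" "q * (1 + \<alpha>) = b - p * c"
    using \<alpha>1 by (simp_all add: p_def q_def)
  then have a: "a = p + \<alpha> * p" and b: "b = q + \<alpha> * q + p * c"
    by (simp_all add: algebra_simps)
  have h1: "h (x + c) = - \<alpha> * h x" for x
    using eq[of x] by (simp add: h_def a b algebra_simps)
  have "\<exists>y. h y \<noteq> 0"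
    using tropical_transcendental_not_affine[OF assms(1)] f by (metis add_0)
  then obtain y where y: "h y \<noteq> 0" by blast
  have "c \<noteq> 0"
  proof
    assume "c = 0"
    then have "(1 + \<alpha>) * h y = 0" using h1[of y] by (simp add: algebra_simps)
    then show False using \<alpha>1 y by simp
  qed
  have "\<alpha> \<noteq> 0"
    using h1[of "y - c"] y by auto
  \<comment> \<open>Doubling the shift replaces the factor \<open>- \<alpha>\<close>, of unknown
    sign, by a positive one.\<close>
  have h2: "h (x + 2 * c) = \<alpha>\<^sup>2 * h x" for x
    using h1[of x] h1[of "x + c"] by (simp add: power2_eq_square algebra_simps)
  have "\<alpha>\<^sup>2 \<noteq> 1" using assms(3,4) by (simp add: power2_eq_1_iff)
  then have "hyper_order f \<ge> 1"
  proof (cases "\<alpha>\<^sup>2 > 1")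
    case True
    show ?thesis
      by (rule hyper_order_ge_1_of_multiplicative[OF tm f h2 True _ y]) (use \<open>c \<noteq> 0\<close> in simp)
  next
    case False
    \<comment> \<open>Here \<open>\<alpha>\<^sup>2\<close> lies strictly between 0 and 1, so
      translating in the opposite direction gives a factor above 1.\<close>
    with \<open>\<alpha>\<^sup>2 \<noteq> 1\<close> \<open>\<alpha> \<noteq> 0\<close> have "inverse (\<alpha>\<^sup>2) > 1"
      by (intro one_less_inverse) auto
    moreover have "h (x + - 2 * c) = inverse (\<alpha>\<^sup>2) * h x" for x
      using h2[of "x - 2 * c"] \<open>\<alpha> \<noteq> 0\<close> by (simp add: field_simps)
    ultimately show ?thesis
      by (intro hyper_order_ge_1_of_multiplicative[OF tm f, where c = "- 2 * c", OF _ _ _ y]) (use \<open>c \<noteq> 0\<close> in auto)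
  qed
  then show False using assms(2) by simp
qed

end
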